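(* Let $(\mathcal{C},\varphi)$ be a $*$-probability space, let $a,b\in\mathcal{C}$, and suppose that $\mathcal{A}_a\prec\mathring{\mathcal{A}}_b$, where $\mathcal{A}_a$ is the (not necessarily unital) $*$-algebra generated by $a$ and $\mathring{\mathcal{A}}_b$ is the $*$-algebra generated by $b$ and $1$. Let $\alpha,\beta$ be non-zero complex numbers and put $p_{\alpha,\beta}=\alpha ab+\beta ba$. Then for every integer $k\geq 1$, $$\varphi(p_{\alpha,\beta}^k)=\frac{\varphi(a^k)}{2^{k+1}\gamma}\left[\left((\alpha+\beta)x+\gamma\right)^{k+1}-\left((\alpha+\beta)x-\gamma\right)^{k+1}\right],$$ where $x=\varphi(b)$ and $\gamma=\sqrt{(\alpha-\beta)^2\varphi(b)^2+4\alpha\beta\varphi(b^2)}$.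
   Context: A $*$-probability space is a pair $(\mathcal{C},\varphi)$ where $\mathcal{C}$ is a unital complex $*$-algebra and $\varphi:\mathcal{C}\to\mathbb{C}$ is linear with $\varphi(1)=1$ and $\varphi(c^*c)\geq 0$ for all $c\in\mathcal{C}$. For $*$-subalgebras $\mathcal{A},\mathcal{B}$ of $\mathcal{C}$ (not necessarily unital), $(\mathcal{A},\mathcal{B})$ is monotone independent, written $\mathcal{A}\prec\mathcal{B}$, if $$\varphi(b_0a_1b_1\cdots a_nb_n)=\varphi(a_1\cdots a_n)\varphi(b_0)\varphi(b_1)\cdots\varphi(b_n)$$ for all $n\ge 1$, $a_1,\dots,a_n\in\mathcal{A}$, $b_1,\dots,b_{n-1}\in\mathcal{B}$, and $b_0,b_n$ each either $1$ or an element of $\mathcal{B}$. *)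

theory Defs
  imports Complex_Main "HOL-Library.Nonpos_Ints"
begin

text \<open>
  No generality is lost by using \<^class>\<open>ring_1\<close>, where \<open>0 \<noteq> 1\<close>: the zero algebra carries
  no linear functional with \<open>\<phi> 1 = 1\<close>.
\<close>

locale complex_star_algebra = vector_space scale
  for scale :: "complex \<Rightarrow> 'a::ring_1 \<Rightarrow> 'a" +
  fixes star :: "'a \<Rightarrow> 'a"
  assumes scale_mult_left: "scale c x * y = scale c (x * y)"
    and scale_mult_right: "x * scale c y = scale c (x * y)"
    and star_star: "star (star x) = x"
    and star_add: "star (x + y) = star x + star y"
    and star_scale: "star (scale c x) = scale (cnj c) (star x)"
    and star_mult: "star (x * y) = star y * star x"

locale star_probability_space = complex_star_algebra scale star
  for scale :: "complex \<Rightarrow> 'a::ring_1 \<Rightarrow> 'a" and star :: "'a \<Rightarrow> 'a" +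
  fixes \<phi> :: "'a \<Rightarrow> complex"
  assumes linear_state: "Vector_Spaces.linear scale (*) \<phi>"
    and state_one: "\<phi> 1 = 1"
    and state_positive: "\<phi> (star c * c) \<in> \<real>\<^sub>\<ge>\<^sub>0"

definition star_subalgebra ::
  "(complex \<Rightarrow> 'a::ring_1 \<Rightarrow> 'a) \<Rightarrow> ('a \<Rightarrow> 'a) \<Rightarrow> 'a set \<Rightarrow> bool" where
  "star_subalgebra scale star A \<longleftrightarrow>
     module.subspace scale A \<and> (\<forall>x\<in>A. \<forall>y\<in>A. x * y \<in> A) \<and> (\<forall>x\<in>A. star x \<in> A)"

text \<open>Not necessarily unital; the unital version is obtained by adding \<open>1\<close> to the generators.\<close>

definition star_algebra_generated ::
  "(complex \<Rightarrow> 'a::ring_1 \<Rightarrow> 'a) \<Rightarrow> ('a \<Rightarrow> 'a) \<Rightarrow> 'a set \<Rightarrow> 'a set" where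
  "star_algebra_generated scale star S = star_subalgebra scale star hull S"

text \<open>
  The word \<open>b\<^sub>0 a\<^sub>1 b\<^sub>1 \<dots> a\<^sub>n b\<^sub>n\<close> is \<open>b\<^sub>0\<close> times the ordered product of the
  \<open>a\<^sub>i b\<^sub>i\<close>, \<open>1 \<le> i \<le> n\<close>; only its outermost letters may be \<open>1\<close> when \<open>1 \<notin> B\<close>.
\<close>

definition monotone_independent ::
  "('a::ring_1 \<Rightarrow> complex) \<Rightarrow> 'a set \<Rightarrow> 'a set \<Rightarrow> bool" where
  "monotone_independent \<phi> A B \<longleftrightarrow>
     (\<forall>n\<ge>1. \<forall>a b :: nat \<Rightarrow> 'a.
        (\<forall>i\<in>{1..n}. a i \<in> A) \<longrightarrow> (\<forall>i\<in>{1..<n}. b i \<in> B) \<longrightarrow>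
        b 0 \<in> insert 1 B \<longrightarrow> b n \<in> insert 1 B \<longrightarrow>
        \<phi> (b 0 * (\<Prod>i\<leftarrow>[1..<Suc n]. a i * b i))
          = \<phi> (\<Prod>i\<leftarrow>[1..<Suc n]. a i) * (\<Prod>i=0..n. \<phi> (b i)))"

end

theory Submission
  imports Defs
begin

text \<open>
  Multiplying a word \<open>f\<^sub>0 a f\<^sub>1 \<dots> a f\<^sub>n\<close> by \<open>p = \<alpha>ab + \<beta>ba\<close> on the right either appends
  the letter \<open>b\<close> or replaces \<open>f\<^sub>n\<close> by \<open>f\<^sub>n b\<close> and appends \<open>1\<close>. By monotone independence
  the moments of words times \<open>p\<^sup>k\<close> therefore depend on \<open>k\<close> only through the powers of
  the matrix with rows \<open>(\<beta>x, \<alpha>)\<close> and \<open>(\<beta>\<phi>(b\<^sup>2), \<alpha>x)\<close>, whose eigenvalues are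
  \<open>((\<alpha> + \<beta>)x \<plusminus> \<gamma>) / 2\<close>. With eigenvalues \<open>\<lambda>\<close> and \<open>\<mu>\<close>, \<open>\<phi>(p\<^sup>k) / \<phi>(a\<^sup>k)\<close> is the
  complete homogeneous polynomial of degree \<open>k\<close> in \<open>\<lambda>, \<mu>\<close>, which is continuous in \<open>\<gamma>\<close>
  and equals \<open>(\<lambda>\<^bsup>k+1\<^esup> - \<mu>\<^bsup>k+1\<^esup>) / (\<lambda> - \<mu>)\<close> when \<open>\<gamma> \<noteq> 0\<close>.
\<close>

lemma star_subalgebra_hull_mult:
  assumes "x \<in> star_algebra_generated scale star S" "y \<in> star_algebra_generated scale star S"
  shows "x * y \<in> star_algebra_generated scale star S"
  using assms unfolding star_algebra_generated_def hull_def star_subalgebra_def by blast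

lemma star_algebra_generated_inc:
  "x \<in> S \<Longrightarrow> x \<in> star_algebra_generated scale star S"
  unfolding star_algebra_generated_def by (rule hull_inc)

text \<open>The recursion exposes the last letter because \<open>p\<close> multiplies words from the
  right.\<close>

fun alternating_word :: "'a::monoid_mult \<Rightarrow> (nat \<Rightarrow> 'a) \<Rightarrow> nat \<Rightarrow> 'a" where
  "alternating_word a f 0 = f 0"
| "alternating_word a f (Suc n) = alternating_word a f n * a * f (Suc n)"

lemma alternating_word_conv_prod_list:
  "alternating_word a f n = f 0 * (\<Prod>i\<leftarrow>[1..<Suc n]. a * f i)"
  by (induction n) (simp_all add: mult.assoc)

lemma alternating_word_cong:
  "(\<And>i. i \<le> n \<Longrightarrow> f i = g i) \<Longrightarrow> alternating_word a f n = alternating_word a g n"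
  by (induction n) simp_all

lemma alternating_word_upd_last:
  "alternating_word a (f(n := f n * c)) n = alternating_word a f n * c"
proof (cases n)
  case (Suc m)
  have "alternating_word a (f(n := f n * c)) m = alternating_word a f m"
    by (rule alternating_word_cong) (simp add: Suc)
  then show ?thesis
    by (simp add: Suc mult.assoc)
qed simp

lemma alternating_word_append:
  "alternating_word a (f(Suc n := c)) (Suc n) = alternating_word a f n * a * c"
  by (simp cong: alternating_word_cong)

lemma prod_list_map_const: "(\<Prod>i\<leftarrow>xs. a) = (a::'a::monoid_mult) ^ length xs"
  by (induction xs) simp_all

text \<open>Independence covers \<open>n \<ge> 1\<close>; the empty product of \<open>a\<close>s at
  \<open>n = 0\<close> is handled by \<open>\<phi> 1 = 1\<close>.\<close>

lemma state_alternating_word: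
  assumes ind: "monotone_independent \<phi> A B" and "\<phi> 1 = 1" and "a \<in> A"
    and f: "\<And>i. i \<le> n \<Longrightarrow> f i \<in> B"
  shows "\<phi> (alternating_word a f n) = \<phi> (a ^ n) * (\<Prod>i\<le>n. \<phi> (f i))"
proof (cases "n = 0")
  case True
  then show ?thesis using \<open>\<phi> 1 = 1\<close> by simp
next
  case False
  then have "\<phi> (f 0 * (\<Prod>i\<leftarrow>[1..<Suc n]. a * f i))
      = \<phi> (\<Prod>i\<leftarrow>[1..<Suc n]. a) * (\<Prod>i=0..n. \<phi> (f i))"
    using ind[unfolded monotone_independent_def, rule_format, of n "\<lambda>_. a" f] \<open>a \<in> A\<close> f
    by simp
  then show ?thesis
    by (simp only: alternating_word_conv_prod_list prod_list_map_const
        length_upt diff_Suc_1 atLeast0AtMost)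
qed

text \<open>The factor of \<open>\<phi>(w c p\<^sup>k)\<close> that comes from the final letter \<open>c\<close> and \<open>p\<^sup>k\<close>.\<close>

fun tail_moment ::
  "('a::ring_1 \<Rightarrow> complex) \<Rightarrow> complex \<Rightarrow> complex \<Rightarrow> 'a \<Rightarrow> nat \<Rightarrow> 'a \<Rightarrow> complex" where
  "tail_moment \<phi> \<alpha> \<beta> b 0 c = \<phi> c"
| "tail_moment \<phi> \<alpha> \<beta> b (Suc k) c =
     \<alpha> * \<phi> c * tail_moment \<phi> \<alpha> \<beta> b k b + \<beta> * \<phi> (c * b) * tail_moment \<phi> \<alpha> \<beta> b k 1"

text \<open>Induction on \<open>k\<close> absorbs the leftmost factor of the power into the word.
  The letter \<open>f n\<close> stays outside the product since that factor may still turn it into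
  \<open>f n * b\<close>. A letter 1 appended this way can end up inside the word, hence
  \<open>1 \<in> B\<close>.\<close>

lemma (in star_probability_space) state_word_times_power:
  assumes ind: "monotone_independent \<phi> A B" and a: "a \<in> A"
    and B: "1 \<in> B" "b \<in> B" "\<And>x y. x \<in> B \<Longrightarrow> y \<in> B \<Longrightarrow> x * y \<in> B"
    and f: "\<And>i. i \<le> n \<Longrightarrow> f i \<in> B"
  shows "\<phi> (alternating_word a f n * (scale \<alpha> (a * b) + scale \<beta> (b * a)) ^ k)
    = \<phi> (a ^ (n + k)) * (\<Prod>i<n. \<phi> (f i)) * tail_moment \<phi> \<alpha> \<beta> b k (f n)"
  using f
proof (induction k arbitrary: n f)
  case 0
  then have "\<phi> (alternating_word a f n) = \<phi> (a ^ n) * (\<Prod>i\<le>n. \<phi> (f i))"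
    by (intro state_alternating_word[where \<phi> = \<phi>, OF ind state_one a]) auto
  moreover have "(\<Prod>i\<le>n. \<phi> (f i)) = (\<Prod>i<n. \<phi> (f i)) * \<phi> (f n)"
    by (simp add: lessThan_Suc_atMost[symmetric])
  ultimately show ?case by simp
next
  case (Suc k)
  define p where "p = scale \<alpha> (a * b) + scale \<beta> (b * a)"
  \<comment> \<open>\<open>g\<close> comes from the summand \<open>\<alpha>ab\<close>,
    \<open>h\<close> from \<open>\<beta>ba\<close>.\<close>
  define g where "g = f(Suc n := b)"
  define h where "h = (f(n := f n * b))(Suc n := 1)"
  have gB: "g i \<in> B" and hB: "h i \<in> B" if "i \<le> Suc n" for i
    using that Suc.prems B by (auto simp: g_def h_def le_Suc_eq)
  have "alternating_word a f n * p
      = scale \<alpha> (alternating_word a g (Suc n)) + scale \<beta> (alternating_word a h (Suc n))"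
    unfolding g_def h_def alternating_word_append alternating_word_upd_last p_def
    by (simp add: distrib_left scale_mult_right mult.assoc)
  then have "\<phi> (alternating_word a f n * p ^ Suc k)
      = \<phi> (scale \<alpha> (alternating_word a g (Suc n) * p ^ k)
          + scale \<beta> (alternating_word a h (Suc n) * p ^ k))"
    by (simp add: mult.assoc[symmetric] distrib_right scale_mult_left
        del: alternating_word.simps)
  also have "\<dots> = \<alpha> * \<phi> (alternating_word a g (Suc n) * p ^ k)
      + \<beta> * \<phi> (alternating_word a h (Suc n) * p ^ k)"
    using linear_state by (simp add: Vector_Spaces.linear_iff)
  also have "\<dots> = \<alpha> * (\<phi> (a ^ (Suc n + k)) * (\<Prod>i<Suc n. \<phi> (g i)) * tail_moment \<phi> \<alpha> \<beta> b k (g (Suc n)))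
      + \<beta> * (\<phi> (a ^ (Suc n + k)) * (\<Prod>i<Suc n. \<phi> (h i)) * tail_moment \<phi> \<alpha> \<beta> b k (h (Suc n)))"
    unfolding p_def using Suc.IH[of "Suc n" g] Suc.IH[of "Suc n" h] gB hB by simp
  also have "(\<Prod>i<Suc n. \<phi> (g i)) = (\<Prod>i<n. \<phi> (f i)) * \<phi> (f n)"
    by (simp add: g_def)
  also have "(\<Prod>i<Suc n. \<phi> (h i)) = (\<Prod>i<n. \<phi> (f i)) * \<phi> (f n * b)"
    by (simp add: h_def)
  finally show ?case
    unfolding p_def by (simp add: g_def h_def algebra_simps)
qed

text \<open>A sum rather than a quotient of differences, so that \<open>x = y\<close> is
  covered.\<close>

definition complete_homogeneous2 :: "'a::comm_ring_1 \<Rightarrow> 'a \<Rightarrow> nat \<Rightarrow> 'a" where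
  "complete_homogeneous2 x y n = (\<Sum>i<Suc n. x ^ i * y ^ (n - i))"

lemma complete_homogeneous2_0 [simp]: "complete_homogeneous2 x y 0 = 1"
  by (simp add: complete_homogeneous2_def)

lemma complete_homogeneous2_Suc:
  "complete_homogeneous2 x y (Suc n) = x ^ Suc n + y * complete_homogeneous2 x y n"
proof -
  have "(\<Sum>i<Suc n. x ^ i * y ^ (Suc n - i)) = (\<Sum>i<Suc n. y * (x ^ i * y ^ (n - i)))"
    by (intro sum.cong) (auto simp: Suc_diff_le algebra_simps)
  then show ?thesis
    by (simp add: complete_homogeneous2_def sum_distrib_left del: sum.lessThan_Suc
        add: sum.lessThan_Suc[of _ "Suc n"])
qed

lemma complete_homogeneous2_rec:
  "complete_homogeneous2 x y (Suc (Suc n))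
    = (x + y) * complete_homogeneous2 x y (Suc n) - x * y * complete_homogeneous2 x y n"
  by (simp add: complete_homogeneous2_Suc algebra_simps)

lemma power_diff_complete_homogeneous2:
  "x ^ Suc n - y ^ Suc n = (x - y) * complete_homogeneous2 x y n"
  unfolding complete_homogeneous2_def by (rule diff_power_eq_sum)

text \<open>
  The second conjunct eliminates the companion sequence \<open>tail_moment \<dots> k b\<close> from the
  two-dimensional recursion.
\<close>

lemma tail_moment_one_eq:
  assumes "\<phi> 1 = 1"
    and sum: "l + m = (\<alpha> + \<beta>) * \<phi> b"
    and prod: "l * m = \<alpha> * \<beta> * ((\<phi> b)\<^sup>2 - \<phi> (b * b))"
  shows "tail_moment \<phi> \<alpha> \<beta> b k 1 = complete_homogeneous2 l m k \<and>
    \<alpha> * tail_moment \<phi> \<alpha> \<beta> b k b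
      = complete_homogeneous2 l m (Suc k) - \<beta> * \<phi> b * complete_homogeneous2 l m k"
proof (induction k)
  case 0
  then show ?case
    using sum by (simp add: \<open>\<phi> 1 = 1\<close> complete_homogeneous2_Suc algebra_simps)
next
  case (Suc k)
  define H where "H = complete_homogeneous2 l m"
  have u: "tail_moment \<phi> \<alpha> \<beta> b k 1 = H k"
    and v: "\<alpha> * tail_moment \<phi> \<alpha> \<beta> b k b = H (Suc k) - \<beta> * \<phi> b * H k"
    using Suc.IH by (simp_all add: H_def)
  \<comment> \<open>The extra factor \<alpha> gives the recursion a form in which \<open>v\<close>
    applies without dividing.\<close>
  have "\<alpha> * tail_moment \<phi> \<alpha> \<beta> b (Suc k) b
      = \<alpha> * \<phi> b * (\<alpha> * tail_moment \<phi> \<alpha> \<beta> b k b) + \<alpha> * \<beta> * \<phi> (b * b) * tail_moment \<phi> \<alpha> \<beta> b k 1"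
    by (simp add: algebra_simps)
  also have "\<dots> = (\<alpha> + \<beta>) * \<phi> b * H (Suc k)
      - \<alpha> * \<beta> * ((\<phi> b)\<^sup>2 - \<phi> (b * b)) * H k - \<beta> * \<phi> b * H (Suc k)"
    unfolding u v by (simp add: algebra_simps power2_eq_square)
  also have "\<dots> = H (Suc (Suc k)) - \<beta> * \<phi> b * H (Suc k)"
    unfolding H_def complete_homogeneous2_rec sum prod ..
  finally show ?case
    using u v \<open>\<phi> 1 = 1\<close> by (simp add: H_def)
qed

text \<open>The two halves differ by exactly \<open>g\<close>, and their powers supply the factor
  \<open>2 ^ (k + 1)\<close>.\<close>

lemma half_sum_diff_power_eq:
  fixes s g :: complex
  assumes "g \<noteq> 0"
  shows "c / (2 ^ (k + 1) * g) * ((s + g) ^ (k + 1) - (s - g) ^ (k + 1))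
    = c * complete_homogeneous2 ((s + g) / 2) ((s - g) / 2) k"
proof -
  have "((s + g) / 2) ^ Suc k - ((s - g) / 2) ^ Suc k
      = g * complete_homogeneous2 ((s + g) / 2) ((s - g) / 2) k"
    unfolding power_diff_complete_homogeneous2 by (simp add: field_simps)
  then have "complete_homogeneous2 ((s + g) / 2) ((s - g) / 2) k
      = (((s + g) / 2) ^ Suc k - ((s - g) / 2) ^ Suc k) / g"
    using assms by simp
  then show ?thesis
    by (simp add: power_divide diff_divide_distrib[symmetric] del: power_Suc)
qed

theorem theorem3p1:
  fixes scale :: "complex \<Rightarrow> 'a::ring_1 \<Rightarrow> 'a"
    and star :: "'a \<Rightarrow> 'a"
    and \<phi> :: "'a \<Rightarrow> complex"
    and a b :: 'a
    and \<alpha> \<beta> \<gamma> :: complex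
    and k :: nat
  assumes "star_probability_space scale star \<phi>"
    and "monotone_independent \<phi>
           (star_algebra_generated scale star {a})
           (star_algebra_generated scale star {b, 1})"
    and "\<alpha> \<noteq> 0" and "\<beta> \<noteq> 0"
    and "\<gamma>\<^sup>2 = (\<alpha> - \<beta>)\<^sup>2 * (\<phi> b)\<^sup>2 + 4 * \<alpha> * \<beta> * \<phi> (b\<^sup>2)"
    and "k \<ge> 1"
  shows "let p = scale \<alpha> (a * b) + scale \<beta> (b * a);
             x = \<phi> b;
             F = (\<lambda>g. \<phi> (a ^ k) / (2 ^ (k + 1) * g) *
                   (((\<alpha> + \<beta>) * x + g) ^ (k + 1) - ((\<alpha> + \<beta>) * x - g) ^ (k + 1)))
         in (\<gamma> \<noteq> 0 \<longrightarrow> \<phi> (p ^ k) = F \<gamma>) \<and>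
            (\<gamma> = 0 \<longrightarrow> (F \<longlongrightarrow> \<phi> (p ^ k)) (at 0))"
proof -
  interpret star_probability_space scale star \<phi> by fact
  define p where "p = scale \<alpha> (a * b) + scale \<beta> (b * a)"
  define s where "s = (\<alpha> + \<beta>) * \<phi> b"
  \<comment> \<open>\<open>G\<close> is polynomial in \<open>g\<close> and so extends
    \<open>F\<close> continuously across 0, where \<open>F\<close> itself only has the default value
    of division by zero.\<close>
  define G where "G g = \<phi> (a ^ k) * complete_homogeneous2 ((s + g) / 2) ((s - g) / 2) k" for g
  define F where "F g = \<phi> (a ^ k) / (2 ^ (k + 1) * g) * ((s + g) ^ (k + 1) - (s - g) ^ (k + 1))"
    for g
  have F_eq: "F g = G g" if "g \<noteq> 0" for g
    unfolding F_def G_def using half_sum_diff_power_eq[OF that] .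
  \<comment> \<open>The starting word is the single letter 1, so the left side is
    \<open>\<phi> (p ^ k)\<close>.\<close>
  have "\<phi> (alternating_word a (\<lambda>_. 1) 0 * p ^ k)
      = \<phi> (a ^ (0 + k)) * (\<Prod>i<(0::nat). \<phi> 1) * tail_moment \<phi> \<alpha> \<beta> b k 1"
    unfolding p_def
    by (rule state_word_times_power[OF assms(2)])
      (auto intro: star_algebra_generated_inc star_subalgebra_hull_mult)
  \<comment> \<open>This product is the determinant of the transfer matrix; the sum \<open>s\<close>
    of the two halves is its trace.\<close>
  moreover have "(s + \<gamma>) / 2 * ((s - \<gamma>) / 2) = \<alpha> * \<beta> * ((\<phi> b)\<^sup>2 - \<phi> (b * b))"
  proof -
    have "(s + \<gamma>) / 2 * ((s - \<gamma>) / 2) = (s\<^sup>2 - \<gamma>\<^sup>2) / 4"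
      by (simp add: power2_eq_square square_diff_square_factored)
    also have "\<dots> = \<alpha> * \<beta> * ((\<phi> b)\<^sup>2 - \<phi> (b * b))"
      unfolding assms(5) s_def by (simp add: field_simps power2_eq_square)
    finally show ?thesis .
  qed
  then have "tail_moment \<phi> \<alpha> \<beta> b k 1
      = complete_homogeneous2 ((s + \<gamma>) / 2) ((s - \<gamma>) / 2) k"
    by (intro tail_moment_one_eq[THEN conjunct1] state_one)
      (simp_all add: s_def field_simps)
  ultimately have moment: "\<phi> (p ^ k) = G \<gamma>"
    by (simp add: G_def)
  have "(G \<longlongrightarrow> G 0) (at 0)"
    unfolding G_def complete_homogeneous2_def by (intro tendsto_intros) simp_all
  moreover have "\<forall>\<^sub>F g in at 0. G g = F g"
    using F_eq by (simp add: eventually_at_filter)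
  ultimately have "(F \<longlongrightarrow> G 0) (at 0)"
    by (rule Lim_transform_eventually)
  then have "(\<gamma> \<noteq> 0 \<longrightarrow> \<phi> (p ^ k) = F \<gamma>) \<and> (\<gamma> = 0 \<longrightarrow> (F \<longlongrightarrow> \<phi> (p ^ k)) (at 0))"
    using moment F_eq by simp
  then show ?thesis
    unfolding Let_def p_def s_def F_def .
qed

end
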